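(* Let $R$ be a commutative ring with identity $1\neq 0$, let $M$ be a $\mathbb{P}$-radical $R$-module and let $f,g\in R$. Then $M_f\cong M_g$ as $R$-modules if and only if $\sqrt{(fM:M)}=\sqrt{(gM:M)}$.
   Context: All rings are commutative with $1\neq 0$ and modules are unital. $M_f$ is the localization of $M$ at $\{1,f,f^2,\dots\}$. For a submodule $N$ of $M$, $(N:M)=\{r\in R: rM\subseteq N\}$, and $\sqrt{I}$ is the radical of an ideal $I$. A proper submodule $P$ of $M$ is prime if for $a\in R$, $m\in M$, $am\in P$ implies $m\in P$ or $aM\subseteq P$. For a submodule $N$ of $M$, the prime radical $\sqrt[p]{N}$ is the intersection of all prime submodules of $M$ containing $N$, and $\sqrt[p]{N}=M$ if there are none. $M$ is called $\mathbb{P}$-radical if $(\sqrt[p]{\mathcal{P}M}:M)=\mathcal{P}$ for every prime ideal $\mathcal{P}\supseteq\mathrm{Ann}(M)$ of $R$. *)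

theory Defs
  imports "HOL-Algebra.Module" "HOL-Algebra.Ideal"
begin

definition ideal_radical :: "('a, 'r) ring_scheme \<Rightarrow> 'a set \<Rightarrow> 'a set" where
  "ideal_radical R I = {r \<in> carrier R. \<exists>n::nat. 0 < n \<and> r [^]\<^bsub>R\<^esub> n \<in> I}"

text \<open>\<open>residual R M N\<close> is the colon ideal \<open>(N : M)\<close>.\<close>

definition residual ::
  "('a, 'r) ring_scheme \<Rightarrow> ('a, 'b, 'm) module_scheme \<Rightarrow> 'b set \<Rightarrow> 'a set" where
  "residual R M N = {r \<in> carrier R. \<forall>x \<in> carrier M. r \<odot>\<^bsub>M\<^esub> x \<in> N}"

definition annihilator ::
  "('a, 'r) ring_scheme \<Rightarrow> ('a, 'b, 'm) module_scheme \<Rightarrow> 'a set" where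
  "annihilator R M = {r \<in> carrier R. \<forall>x \<in> carrier M. r \<odot>\<^bsub>M\<^esub> x = \<zero>\<^bsub>M\<^esub>}"

definition submodule_span ::
  "('a, 'r) ring_scheme \<Rightarrow> ('a, 'b, 'm) module_scheme \<Rightarrow> 'b set \<Rightarrow> 'b set" where
  "submodule_span R M S = \<Inter>{N. submodule N R M \<and> S \<subseteq> N}"

text \<open>The submodule \<open>IM\<close> is generated by the products \<open>ax\<close> with \<open>a \<in> I\<close>, \<open>x \<in> M\<close>.\<close>

definition ideal_smult ::
  "('a, 'r) ring_scheme \<Rightarrow> 'a set \<Rightarrow> ('a, 'b, 'm) module_scheme \<Rightarrow> 'b set" where
  "ideal_smult R I M = submodule_span R M {a \<odot>\<^bsub>M\<^esub> x | a x. a \<in> I \<and> x \<in> carrier M}"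

definition elt_smult :: "'a \<Rightarrow> ('a, 'b, 'm) module_scheme \<Rightarrow> 'b set" where
  "elt_smult f M = (\<lambda>x. f \<odot>\<^bsub>M\<^esub> x) ` carrier M"

definition prime_submodule ::
  "'b set \<Rightarrow> ('a, 'r) ring_scheme \<Rightarrow> ('a, 'b, 'm) module_scheme \<Rightarrow> bool" where
  "prime_submodule P R M \<longleftrightarrow>
     submodule P R M \<and> P \<noteq> carrier M \<and>
     (\<forall>a \<in> carrier R. \<forall>m \<in> carrier M.
        a \<odot>\<^bsub>M\<^esub> m \<in> P \<longrightarrow> m \<in> P \<or> elt_smult a M \<subseteq> P)"

definition prime_radical ::
  "('a, 'r) ring_scheme \<Rightarrow> ('a, 'b, 'm) module_scheme \<Rightarrow> 'b set \<Rightarrow> 'b set" where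
  "prime_radical R M N =
     (if \<exists>P. prime_submodule P R M \<and> N \<subseteq> P
      then \<Inter>{P. prime_submodule P R M \<and> N \<subseteq> P}
      else carrier M)"

definition P_radical_module ::
  "('a, 'r) ring_scheme \<Rightarrow> ('a, 'b, 'm) module_scheme \<Rightarrow> bool" where
  "P_radical_module R M \<longleftrightarrow>
     module R M \<and>
     (\<forall>P. primeideal P R \<and> annihilator R M \<subseteq> P \<longrightarrow>
          residual R M (prime_radical R M (ideal_smult R P M)) = P)"

definition powers_of :: "('a, 'r) ring_scheme \<Rightarrow> 'a \<Rightarrow> 'a set" where
  "powers_of R f = {f [^]\<^bsub>R\<^esub> n | n::nat. True}"

definition fraction_rel ::
  "('a, 'r) ring_scheme \<Rightarrow> 'a set \<Rightarrow> ('a, 'b, 'm) module_scheme \<Rightarrow>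
     (('b \<times> 'a) \<times> ('b \<times> 'a)) set" where
  "fraction_rel R S M =
     {((m, s), (n, t)) | m s n t.
        m \<in> carrier M \<and> n \<in> carrier M \<and> s \<in> S \<and> t \<in> S \<and>
        (\<exists>u \<in> S. u \<odot>\<^bsub>M\<^esub> (t \<odot>\<^bsub>M\<^esub> m) = u \<odot>\<^bsub>M\<^esub> (s \<odot>\<^bsub>M\<^esub> n))}"

text \<open>\<open>fraction R S M m s\<close> is the fraction \<open>m/s\<close>.\<close>

definition fraction ::
  "('a, 'r) ring_scheme \<Rightarrow> 'a set \<Rightarrow> ('a, 'b, 'm) module_scheme \<Rightarrow>
     'b \<Rightarrow> 'a \<Rightarrow> ('b \<times> 'a) set" where
  "fraction R S M m s = fraction_rel R S M `` {(m, s)}"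

text \<open>
  The \<open>R\<close>-module \<open>S\<inverse>M\<close>, for \<open>S\<close> a multiplicative submonoid of \<open>R\<close> (possibly containing 0).
  The operations take the union over all representatives; the classes united are equal
  (lemmas \<open>localization_add_fraction\<close> and \<open>localization_smult_fraction\<close> below). The record
  fields \<open>mult\<close> and \<open>one\<close> play no role for modules.
\<close>

definition localization ::
  "('a, 'r) ring_scheme \<Rightarrow> 'a set \<Rightarrow> ('a, 'b, 'm) module_scheme \<Rightarrow>
     ('a, ('b \<times> 'a) set) module" where
  "localization R S M =
     \<lparr>carrier = (carrier M \<times> S) // fraction_rel R S M,
      mult = (\<lambda>_ _. undefined),
      one = undefined,
      zero = fraction R S M \<zero>\<^bsub>M\<^esub> \<one>\<^bsub>R\<^esub>,
      add = (\<lambda>X Y. \<Union>(m, s) \<in> X. \<Union>(n, t) \<in> Y.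
               fraction R S M (t \<odot>\<^bsub>M\<^esub> m \<oplus>\<^bsub>M\<^esub> s \<odot>\<^bsub>M\<^esub> n) (s \<otimes>\<^bsub>R\<^esub> t)),
      smult = (\<lambda>r X. \<Union>(m, s) \<in> X. fraction R S M (r \<odot>\<^bsub>M\<^esub> m) s)\<rparr>"

definition localization_at ::
  "('a, 'r) ring_scheme \<Rightarrow> ('a, 'b, 'm) module_scheme \<Rightarrow> 'a \<Rightarrow>
     ('a, ('b \<times> 'a) set) module" where
  "localization_at R M f = localization R (powers_of R f) M"

definition module_iso ::
  "('a, 'r) ring_scheme \<Rightarrow> ('a, 'b, 'm) module_scheme \<Rightarrow> ('a, 'c, 'n) module_scheme \<Rightarrow>
     ('b \<Rightarrow> 'c) set" where
  "module_iso R M N =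
     {h. bij_betw h (carrier M) (carrier N) \<and>
         (\<forall>x \<in> carrier M. \<forall>y \<in> carrier M. h (x \<oplus>\<^bsub>M\<^esub> y) = h x \<oplus>\<^bsub>N\<^esub> h y) \<and>
         (\<forall>r \<in> carrier R. \<forall>x \<in> carrier M. h (r \<odot>\<^bsub>M\<^esub> x) = r \<odot>\<^bsub>N\<^esub> h x)}"

definition module_isomorphic ::
  "('a, 'r) ring_scheme \<Rightarrow> ('a, 'b, 'm) module_scheme \<Rightarrow> ('a, 'c, 'n) module_scheme \<Rightarrow> bool" where
  "module_isomorphic R M N \<longleftrightarrow> module_iso R M N \<noteq> {}"

lemma (in cring) powers_of_submonoid:
  assumes "f \<in> carrier R"
  shows "submonoid (powers_of R f) R"
proof
  show "powers_of R f \<subseteq> carrier R"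
    using assms by (auto simp: powers_of_def)
  show "\<one> \<in> powers_of R f"
    unfolding powers_of_def by (auto intro!: exI[of _ 0])
  show "x \<otimes> y \<in> powers_of R f" if "x \<in> powers_of R f" "y \<in> powers_of R f" for x y
    using that assms unfolding powers_of_def by (auto simp: nat_pow_mult)
qed

lemma UN_pair_const:
  assumes "p \<in> X" and "\<And>m s. (m, s) \<in> X \<Longrightarrow> F m s = C"
  shows "(\<Union>(m, s) \<in> X. F m s) = C"
proof -
  have "(case q of (m, s) \<Rightarrow> F m s) = C" if "q \<in> X" for q
    using assms(2) that by (cases q) simp
  with assms(1) show ?thesis by blast
qed

context module
begin

context
  fixes S
  assumes S: "submonoid S R"
begin

lemma den_closed: "s \<in> S \<Longrightarrow> s \<in> carrier R"
  using submonoid.subset[OF S] by blast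

lemma den_mult: "s \<in> S \<Longrightarrow> t \<in> S \<Longrightarrow> s \<otimes> t \<in> S"
  using submonoid.m_closed[OF S] by blast

lemma den_one: "\<one> \<in> S"
  using submonoid.one_closed[OF S] by blast

lemma smult_left_commute:
  "a \<in> carrier R \<Longrightarrow> b \<in> carrier R \<Longrightarrow> x \<in> carrier M \<Longrightarrow>
     a \<odot>\<^bsub>M\<^esub> (b \<odot>\<^bsub>M\<^esub> x) = b \<odot>\<^bsub>M\<^esub> (a \<odot>\<^bsub>M\<^esub> x)"
  by (metis R.m_comm smult_assoc1)

lemma fraction_rel_equiv: "equiv (carrier M \<times> S) (fraction_rel R S M)"
proof (rule equivI)
  show "fraction_rel R S M \<subseteq> (carrier M \<times> S) \<times> (carrier M \<times> S)"
    by (auto simp: fraction_rel_def)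
  show "refl_on (carrier M \<times> S) (fraction_rel R S M)"
    using den_one by (auto simp: fraction_rel_def refl_on_def)
  show "sym (fraction_rel R S M)"
    by (rule symI) (auto simp: fraction_rel_def, metis)
  show "trans (fraction_rel R S M)"
  proof (rule transI)
    fix x y z assume xy: "(x, y) \<in> fraction_rel R S M" and yz: "(y, z) \<in> fraction_rel R S M"
    obtain m s n t u where x: "x = (m, s)" and y: "y = (n, t)"
      and 1: "m \<in> carrier M" "n \<in> carrier M" "s \<in> S" "t \<in> S" "u \<in> S"
        "u \<odot>\<^bsub>M\<^esub> (t \<odot>\<^bsub>M\<^esub> m) = u \<odot>\<^bsub>M\<^esub> (s \<odot>\<^bsub>M\<^esub> n)"
      using xy by (auto simp: fraction_rel_def)
    obtain p q v where z: "z = (p, q)"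
      and 2: "p \<in> carrier M" "q \<in> S" "v \<in> S"
        "v \<odot>\<^bsub>M\<^esub> (q \<odot>\<^bsub>M\<^esub> n) = v \<odot>\<^bsub>M\<^esub> (t \<odot>\<^bsub>M\<^esub> p)"
      using yz y by (auto simp: fraction_rel_def)
    note c = 1(1,2) 2(1) 1(3-5)[THEN den_closed] 2(2,3)[THEN den_closed]
    have "(u \<otimes> v \<otimes> t) \<odot>\<^bsub>M\<^esub> (q \<odot>\<^bsub>M\<^esub> m) = v \<odot>\<^bsub>M\<^esub> (q \<odot>\<^bsub>M\<^esub> (u \<odot>\<^bsub>M\<^esub> (t \<odot>\<^bsub>M\<^esub> m)))"
      using c by (simp add: smult_assoc1 smult_left_commute)
    also have "\<dots> = u \<odot>\<^bsub>M\<^esub> (s \<odot>\<^bsub>M\<^esub> (v \<odot>\<^bsub>M\<^esub> (q \<odot>\<^bsub>M\<^esub> n)))"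
      unfolding 1(6) using c by (simp add: smult_left_commute)
    also have "\<dots> = (u \<otimes> v \<otimes> t) \<odot>\<^bsub>M\<^esub> (s \<odot>\<^bsub>M\<^esub> p)"
      unfolding 2(4) using c by (simp add: smult_assoc1 smult_left_commute)
    finally show "(x, z) \<in> fraction_rel R S M"
      using 1 2 den_mult unfolding fraction_rel_def x z by auto
  qed
qed

lemma fraction_eq_iff:
  assumes "m \<in> carrier M" "s \<in> S" "n \<in> carrier M" "t \<in> S"
  shows "fraction R S M m s = fraction R S M n t \<longleftrightarrow>
           (\<exists>u \<in> S. u \<odot>\<^bsub>M\<^esub> (t \<odot>\<^bsub>M\<^esub> m) = u \<odot>\<^bsub>M\<^esub> (s \<odot>\<^bsub>M\<^esub> n))"
  unfolding fraction_def using assms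
  by (subst eq_equiv_class_iff[OF fraction_rel_equiv]) (auto simp: fraction_rel_def)

lemma mem_fraction_iff:
  assumes "m \<in> carrier M" "s \<in> S"
  shows "(n, t) \<in> fraction R S M m s \<longleftrightarrow>
           n \<in> carrier M \<and> t \<in> S \<and> fraction R S M n t = fraction R S M m s"
  using assms equiv_class_eq_iff[OF fraction_rel_equiv, of "(m, s)" "(n, t)"]
  by (auto simp: fraction_def)

lemma localization_carrier:
  "carrier (localization R S M) = {fraction R S M m s | m s. m \<in> carrier M \<and> s \<in> S}"
  by (auto simp: localization_def quotient_def fraction_def)

lemma localization_zero: "\<zero>\<^bsub>localization R S M\<^esub> = fraction R S M \<zero>\<^bsub>M\<^esub> \<one>"
  by (simp add: localization_def)

lemma localization_add_fraction:
  assumes m: "m \<in> carrier M" and s: "s \<in> S" and n: "n \<in> carrier M" and t: "t \<in> S"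
  shows "fraction R S M m s \<oplus>\<^bsub>localization R S M\<^esub> fraction R S M n t =
           fraction R S M (t \<odot>\<^bsub>M\<^esub> m \<oplus>\<^bsub>M\<^esub> s \<odot>\<^bsub>M\<^esub> n) (s \<otimes> t)"
proof -
  have eq: "fraction R S M (t' \<odot>\<^bsub>M\<^esub> m' \<oplus>\<^bsub>M\<^esub> s' \<odot>\<^bsub>M\<^esub> n') (s' \<otimes> t') =
              fraction R S M (t \<odot>\<^bsub>M\<^esub> m \<oplus>\<^bsub>M\<^esub> s \<odot>\<^bsub>M\<^esub> n) (s \<otimes> t)"
    if "(m', s') \<in> fraction R S M m s" "(n', t') \<in> fraction R S M n t" for m' s' n' t'
  proof -
    have 1: "m' \<in> carrier M" "s' \<in> S" "n' \<in> carrier M" "t' \<in> S"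
      and "fraction R S M m' s' = fraction R S M m s" "fraction R S M n' t' = fraction R S M n t"
      using that m s n t by (simp_all add: mem_fraction_iff)
    then obtain u v where u: "u \<in> S" "u \<odot>\<^bsub>M\<^esub> (s \<odot>\<^bsub>M\<^esub> m') = u \<odot>\<^bsub>M\<^esub> (s' \<odot>\<^bsub>M\<^esub> m)"
      and v: "v \<in> S" "v \<odot>\<^bsub>M\<^esub> (t \<odot>\<^bsub>M\<^esub> n') = v \<odot>\<^bsub>M\<^esub> (t' \<odot>\<^bsub>M\<^esub> n)"
      using m s n t by (auto simp: fraction_eq_iff)
    note c = 1(1,3) m n 1(2,4)[THEN den_closed] s[THEN den_closed] t[THEN den_closed]
      u(1)[THEN den_closed] v(1)[THEN den_closed]
    have "(u \<otimes> v) \<odot>\<^bsub>M\<^esub> ((s \<otimes> t) \<odot>\<^bsub>M\<^esub> (t' \<odot>\<^bsub>M\<^esub> m' \<oplus>\<^bsub>M\<^esub> s' \<odot>\<^bsub>M\<^esub> n')) =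
        v \<odot>\<^bsub>M\<^esub> (t \<odot>\<^bsub>M\<^esub> (t' \<odot>\<^bsub>M\<^esub> (u \<odot>\<^bsub>M\<^esub> (s \<odot>\<^bsub>M\<^esub> m')))) \<oplus>\<^bsub>M\<^esub>
        u \<odot>\<^bsub>M\<^esub> (s \<odot>\<^bsub>M\<^esub> (s' \<odot>\<^bsub>M\<^esub> (v \<odot>\<^bsub>M\<^esub> (t \<odot>\<^bsub>M\<^esub> n'))))"
      using c by (simp add: smult_assoc1 smult_r_distr smult_left_commute)
    also have "\<dots> = (u \<otimes> v) \<odot>\<^bsub>M\<^esub> ((s' \<otimes> t') \<odot>\<^bsub>M\<^esub> (t \<odot>\<^bsub>M\<^esub> m \<oplus>\<^bsub>M\<^esub> s \<odot>\<^bsub>M\<^esub> n))"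
      unfolding u(2) v(2)
      using c by (simp add: smult_assoc1 smult_r_distr smult_left_commute)
    finally show ?thesis
      using c 1 m s n t u(1) v(1)
      by (subst fraction_eq_iff) (auto intro!: den_mult bexI[of _ "u \<otimes> v"])
  qed
  have "(m, s) \<in> fraction R S M m s" "(n, t) \<in> fraction R S M n t"
    using assms by (simp_all add: mem_fraction_iff)
  note mem = this
  show ?thesis
    unfolding localization_def module.simps ring.simps
    by (rule UN_pair_const[OF mem(1)], rule UN_pair_const[OF mem(2)], rule eq)
qed

lemma localization_smult_fraction:
  assumes r: "r \<in> carrier R" and m: "m \<in> carrier M" and s: "s \<in> S"
  shows "r \<odot>\<^bsub>localization R S M\<^esub> fraction R S M m s = fraction R S M (r \<odot>\<^bsub>M\<^esub> m) s"
proof -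
  have eq: "fraction R S M (r \<odot>\<^bsub>M\<^esub> m') s' = fraction R S M (r \<odot>\<^bsub>M\<^esub> m) s"
    if "(m', s') \<in> fraction R S M m s" for m' s'
  proof -
    have 1: "m' \<in> carrier M" "s' \<in> S" and "fraction R S M m' s' = fraction R S M m s"
      using that m s by (simp_all add: mem_fraction_iff)
    then obtain u where u: "u \<in> S" "u \<odot>\<^bsub>M\<^esub> (s \<odot>\<^bsub>M\<^esub> m') = u \<odot>\<^bsub>M\<^esub> (s' \<odot>\<^bsub>M\<^esub> m)"
      using m s by (auto simp: fraction_eq_iff)
    have "u \<odot>\<^bsub>M\<^esub> (s \<odot>\<^bsub>M\<^esub> (r \<odot>\<^bsub>M\<^esub> m')) = r \<odot>\<^bsub>M\<^esub> (u \<odot>\<^bsub>M\<^esub> (s \<odot>\<^bsub>M\<^esub> m'))"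
      using r 1 s u(1) by (simp add: smult_left_commute den_closed)
    also have "\<dots> = u \<odot>\<^bsub>M\<^esub> (s' \<odot>\<^bsub>M\<^esub> (r \<odot>\<^bsub>M\<^esub> m))"
      unfolding u(2) using r 1 m u(1) by (simp add: smult_left_commute den_closed)
    finally show ?thesis
      using r 1 m s u(1) by (subst fraction_eq_iff) auto
  qed
  have "(m, s) \<in> fraction R S M m s"
    using assms by (simp add: mem_fraction_iff)
  note mem = this
  show ?thesis
    unfolding localization_def module.simps
    by (rule UN_pair_const[OF mem], rule eq)
qed

lemma localization_module: "module R (localization R S M)"
proof (rule moduleI)
  note [simp] = localization_add_fraction localization_smult_fraction localization_zero
    den_closed den_mult den_one
  let ?L = "localization R S M"
  have ex: "\<exists>m s. m \<in> carrier M \<and> s \<in> S \<and> x = fraction R S M m s" if "x \<in> carrier ?L" for x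
    using that by (auto simp: localization_carrier)
  have cl: "fraction R S M m s \<in> carrier ?L" if "m \<in> carrier M" "s \<in> S" for m s
    using that by (auto simp: localization_carrier)
  have eqI: "fraction R S M m s = fraction R S M n t"
    if "t \<odot>\<^bsub>M\<^esub> m = s \<odot>\<^bsub>M\<^esub> n" "m \<in> carrier M" "s \<in> S" "n \<in> carrier M" "t \<in> S" for m s n t
    using that by (subst fraction_eq_iff) auto
  note ac = smult_assoc1 smult_r_distr smult_left_commute M.a_ac
  show "cring R" ..
  show "abelian_group ?L"
  proof (rule abelian_groupI)
    show "\<zero>\<^bsub>?L\<^esub> \<in> carrier ?L" by (simp add: cl)
  next
    fix x y assume "x \<in> carrier ?L" "y \<in> carrier ?L"
    then obtain m s n t where xy: "m \<in> carrier M" "s \<in> S" "n \<in> carrier M" "t \<in> S"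
      "x = fraction R S M m s" "y = fraction R S M n t" using ex by metis
    show "x \<oplus>\<^bsub>?L\<^esub> y \<in> carrier ?L" using xy by (simp add: cl)
    show "x \<oplus>\<^bsub>?L\<^esub> y = y \<oplus>\<^bsub>?L\<^esub> x" using xy by (simp add: M.a_comm R.m_comm)
  next
    fix x y z assume "x \<in> carrier ?L" "y \<in> carrier ?L" "z \<in> carrier ?L"
    then obtain m s n t p q where "m \<in> carrier M" "s \<in> S" "n \<in> carrier M" "t \<in> S"
      "p \<in> carrier M" "q \<in> S"
      "x = fraction R S M m s" "y = fraction R S M n t" "z = fraction R S M p q" using ex by metis
    then show "(x \<oplus>\<^bsub>?L\<^esub> y) \<oplus>\<^bsub>?L\<^esub> z = x \<oplus>\<^bsub>?L\<^esub> (y \<oplus>\<^bsub>?L\<^esub> z)"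
      by (simp add: ac R.m_ac)
  next
    fix x assume "x \<in> carrier ?L"
    then obtain m s where x: "m \<in> carrier M" "s \<in> S" "x = fraction R S M m s" using ex by metis
    show "\<zero>\<^bsub>?L\<^esub> \<oplus>\<^bsub>?L\<^esub> x = x" using x by simp
    have "fraction R S M (\<ominus>\<^bsub>M\<^esub> m) s \<oplus>\<^bsub>?L\<^esub> x = \<zero>\<^bsub>?L\<^esub>"
      using x by (simp add: smult_r_distr[symmetric] M.l_neg) (rule eqI; simp)
    with x show "\<exists>y \<in> carrier ?L. y \<oplus>\<^bsub>?L\<^esub> x = \<zero>\<^bsub>?L\<^esub>"
      by (blast intro: cl M.a_inv_closed)
  qed
next
  note [simp] = localization_add_fraction localization_smult_fraction localization_zero
    den_closed den_mult den_one
  let ?L = "localization R S M"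
  have ex: "\<exists>m s. m \<in> carrier M \<and> s \<in> S \<and> x = fraction R S M m s" if "x \<in> carrier ?L" for x
    using that by (auto simp: localization_carrier)
  have eqI: "fraction R S M m s = fraction R S M n t"
    if "t \<odot>\<^bsub>M\<^esub> m = s \<odot>\<^bsub>M\<^esub> n" "m \<in> carrier M" "s \<in> S" "n \<in> carrier M" "t \<in> S" for m s n t
    using that by (subst fraction_eq_iff) auto
  show "\<one> \<odot>\<^bsub>?L\<^esub> x = x" if "x \<in> carrier ?L" for x
    using ex[OF that] by auto
  fix a x assume a: "a \<in> carrier R" and "x \<in> carrier ?L"
  then obtain m s where x: "m \<in> carrier M" "s \<in> S" "x = fraction R S M m s" using ex by metis
  show "a \<odot>\<^bsub>?L\<^esub> x \<in> carrier ?L" using a x by (auto simp: localization_carrier)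
  fix b assume b: "b \<in> carrier R"
  show "(a \<otimes> b) \<odot>\<^bsub>?L\<^esub> x = a \<odot>\<^bsub>?L\<^esub> (b \<odot>\<^bsub>?L\<^esub> x)"
    using a b x by (simp add: smult_assoc1)
  have "(s \<otimes> s) \<odot>\<^bsub>M\<^esub> (a \<odot>\<^bsub>M\<^esub> m \<oplus>\<^bsub>M\<^esub> b \<odot>\<^bsub>M\<^esub> m) =
      s \<odot>\<^bsub>M\<^esub> (s \<odot>\<^bsub>M\<^esub> (a \<odot>\<^bsub>M\<^esub> m) \<oplus>\<^bsub>M\<^esub> s \<odot>\<^bsub>M\<^esub> (b \<odot>\<^bsub>M\<^esub> m))"
    using a b x(1,2) by (simp only: smult_r_distr smult_assoc1 smult_closed den_closed M.a_closed)
  then have "fraction R S M (a \<odot>\<^bsub>M\<^esub> m \<oplus>\<^bsub>M\<^esub> b \<odot>\<^bsub>M\<^esub> m) s =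
      fraction R S M (s \<odot>\<^bsub>M\<^esub> (a \<odot>\<^bsub>M\<^esub> m) \<oplus>\<^bsub>M\<^esub> s \<odot>\<^bsub>M\<^esub> (b \<odot>\<^bsub>M\<^esub> m)) (s \<otimes> s)"
    using a b x(1,2) by (intro eqI) auto
  then show "(a \<oplus> b) \<odot>\<^bsub>?L\<^esub> x = a \<odot>\<^bsub>?L\<^esub> x \<oplus>\<^bsub>?L\<^esub> b \<odot>\<^bsub>?L\<^esub> x"
    using a b x by (simp add: smult_l_distr)
next
  note [simp] = localization_add_fraction localization_smult_fraction den_closed den_mult
  let ?L = "localization R S M"
  fix a x y assume a: "a \<in> carrier R" and "x \<in> carrier ?L" "y \<in> carrier ?L"
  then obtain m s n t where "m \<in> carrier M" "s \<in> S" "n \<in> carrier M" "t \<in> S"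
    "x = fraction R S M m s" "y = fraction R S M n t" by (auto simp: localization_carrier)
  with a show "a \<odot>\<^bsub>?L\<^esub> (x \<oplus>\<^bsub>?L\<^esub> y) = a \<odot>\<^bsub>?L\<^esub> x \<oplus>\<^bsub>?L\<^esub> a \<odot>\<^bsub>?L\<^esub> y"
    by (simp add: smult_r_distr smult_left_commute)
qed

end

end

end

(* For a P-radical module, sqrt(fM : M) = sqrt(fR + Ann M), and r lies in it iff every prime
   submodule Q with fM <= Q satisfies rM <= Q: a prime ideal containing fR + Ann M but no power
   of r would be the colon of an intersection of prime submodules containing fM, hence contain r.
   If M_f is isomorphic to M_g, then f acts surjectively on M_g, so every m in M has some
   g^k m in fM; thus a prime submodule containing fM contains gM, and symmetrically.
   Conversely, if f and g divide powers of each other modulo Ann M, then the powers of f and of g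
   have the same saturation modulo Ann M, and saturating does not change the localization. *)

theory Submission
  imports "HOL-Algebra.Ring_Divisibility" Defs
begin

section \<open>Prime ideals that avoid the powers of an element\<close>

context cring
begin

text \<open>Zorn's lemma gives an ideal that is maximal among those containing \<open>I\<close> and
  no power of \<open>g\<close>; such a maximal ideal is prime.\<close>

lemma exists_primeideal_avoiding:
  assumes I: "ideal I R" and g: "g \<in> carrier R" and gI: "\<And>n::nat. g [^] n \<notin> I"
  obtains P where "primeideal P R" "I \<subseteq> P" "g \<notin> P"
proof -
  \<comment> \<open>The exponent 0 is included, so no member contains \<one>; this later makes
    \<open>P\<close> proper.\<close>
  define \<A> where "\<A> = {J. ideal J R \<and> I \<subseteq> J \<and> (\<forall>n::nat. g [^] n \<notin> J)}"
  have "\<exists>P\<in>\<A>. \<forall>J\<in>\<A>. P \<subseteq> J \<longrightarrow> J = P"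
  proof (rule subset_Zorn_nonempty)
    show "\<A> \<noteq> {}" using I gI by (auto simp: \<A>_def)
    fix \<C> assume ne: "\<C> \<noteq> {}" and ch: "subset.chain \<A> \<C>"
    have sub: "\<C> \<subseteq> \<A>" using ch by (simp add: subset.chain_def)
    have "subset.chain {J. ideal J R} \<C>"
      using ch by (auto simp: \<A>_def subset.chain_def)
    from chain_Union_is_ideal[OF this] ne have "ideal (\<Union>\<C>) R" by simp
    then show "\<Union>\<C> \<in> \<A>" using ne sub by (fastforce simp: \<A>_def)
  qed
  then obtain P where PA: "P \<in> \<A>" and max: "\<And>J. J \<in> \<A> \<Longrightarrow> P \<subseteq> J \<Longrightarrow> J = P" by blast
  interpret P: ideal P R using PA by (simp add: \<A>_def)
  have IP: "I \<subseteq> P" and gP: "\<And>n::nat. g [^] n \<notin> P" using PA by (auto simp: \<A>_def)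
  \<comment> \<open>The ideal \<open>P + Ra\<close> strictly contains \<open>P\<close>, so by
    maximality it falls outside \<A>, which can only happen by containing a power of
    \<open>g\<close>.\<close>
  have hits: "\<exists>n::nat. \<exists>p\<in>P. \<exists>r\<in>carrier R. g [^] n = p \<oplus> r \<otimes> a" if a: "a \<in> carrier R" "a \<notin> P" for a
  proof (rule ccontr)
    assume no: "\<not> ?thesis"
    let ?J = "P <+>\<^bsub>R\<^esub> PIdl a"
    have J: "ideal ?J R" by (rule add_ideals[OF P.is_ideal cgenideal_ideal[OF a(1)]])
    have eq: "?J = {p \<oplus> r \<otimes> a | p r. p \<in> P \<and> r \<in> carrier R}"
      by (auto simp: set_add_def' cgenideal_def)
    have PJ: "p \<in> ?J" if "p \<in> P" for p
      unfolding eq using that P.Icarr[OF that] a by (intro CollectI exI[of _ p] exI[of _ \<zero>] conjI) simp_all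
    have "a \<in> ?J"
      unfolding eq using a P.zero_closed by (intro CollectI exI[of _ \<zero>] exI[of _ \<one>] conjI) simp_all
    moreover have "?J \<in> \<A>" unfolding \<A>_def using J IP PJ no by (auto simp: eq)
    ultimately show False using max[of ?J] PJ a by blast
  qed
  have "primeideal P R"
  proof (rule primeidealI)
    show "ideal P R" by (rule P.is_ideal)
    show "cring R" ..
    show "carrier R \<noteq> P" using gP[of 0] by auto
    fix a b assume ab: "a \<in> carrier R" "b \<in> carrier R" "a \<otimes> b \<in> P"
    show "a \<in> P \<or> b \<in> P"
    proof (rule ccontr)
      assume "\<not> ?thesis"
      with hits ab obtain i j :: nat and p q r s where
        1: "p \<in> P" "r \<in> carrier R" "g [^] i = p \<oplus> r \<otimes> a"
           "q \<in> P" "s \<in> carrier R" "g [^] j = q \<oplus> s \<otimes> b" by metis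
      have c: "p \<in> carrier R" "q \<in> carrier R" using 1 P.Icarr by auto
      \<comment> \<open>Expanding the product of the two expressions leaves terms with a factor
        \<open>p\<close>, \<open>q\<close> or \<open>a \<otimes> b\<close>, all of which lie in
        \<open>P\<close>.\<close>
      have "g [^] (i + j) = p \<otimes> (q \<oplus> s \<otimes> b) \<oplus> (r \<otimes> a) \<otimes> q \<oplus> (r \<otimes> s) \<otimes> (a \<otimes> b)"
        unfolding nat_pow_mult[OF g, symmetric] 1(3,6)
        using 1(2,5) c ab(1,2) by (simp add: l_distr r_distr a_ac m_ac)
      also have "\<dots> \<in> P" using 1(1,2,4,5) c ab by (simp add: P.a_closed P.I_l_closed P.I_r_closed)
      finally show False using gP by blast
    qed
  qed
  moreover have "g \<notin> P" using gP[of 1] g by simp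
  ultimately show thesis using IP that by blast
qed

end

section \<open>Prime submodules and the radical of the colon ideal \<open>(fM : M)\<close>\<close>

context module
begin

text \<open>Primeness strips off one factor \<open>g\<close> at a time: at each stage either
  \<open>gM\<close> lies in \<open>Q\<close> or the exponent drops by one.\<close>

lemma smult_pow_in_prime_submodule:
  assumes Q: "prime_submodule Q R M" and g: "g \<in> carrier R" and m: "m \<in> carrier M"
    and "(g [^] (n::nat)) \<odot>\<^bsub>M\<^esub> m \<in> Q"
  shows "m \<in> Q \<or> elt_smult g M \<subseteq> Q"
  using assms(4)
proof (induction n)
  case (Suc n)
  have "(g [^] Suc n) \<odot>\<^bsub>M\<^esub> m = g \<odot>\<^bsub>M\<^esub> ((g [^] n) \<odot>\<^bsub>M\<^esub> m)"
    using g m by (simp add: smult_assoc1[symmetric] R.m_comm)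
  with Suc show ?case using Q g m unfolding prime_submodule_def by (metis R.nat_pow_closed smult_closed)
qed (use m in simp)

text \<open>The ideal \<open>fR + Ann M\<close>.\<close>

definition multiples_on :: "'a \<Rightarrow> 'a set" where
  "multiples_on f = {r \<in> carrier R. \<exists>a\<in>carrier R. \<forall>x\<in>carrier M. r \<odot>\<^bsub>M\<^esub> x = (a \<otimes> f) \<odot>\<^bsub>M\<^esub> x}"

lemma multiples_on_ideal:
  assumes f: "f \<in> carrier R"
  shows "ideal (multiples_on f) R"
proof (rule idealI)
  show "ring R" ..
  show "subgroup (multiples_on f) (add_monoid R)"
  proof (rule group.subgroupI)
    show "group (add_monoid R)" by (rule R.add.is_group)
    show "multiples_on f \<subseteq> carrier (add_monoid R)" by (auto simp: multiples_on_def)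
    show "multiples_on f \<noteq> {}" using f by (auto simp: multiples_on_def)
    fix r assume "r \<in> multiples_on f"
    then obtain a where r: "r \<in> carrier R" "a \<in> carrier R"
        "\<And>x. x \<in> carrier M \<Longrightarrow> r \<odot>\<^bsub>M\<^esub> x = (a \<otimes> f) \<odot>\<^bsub>M\<^esub> x" by (auto simp: multiples_on_def)
    then have "\<ominus> r \<in> multiples_on f"
      using f by (auto simp: multiples_on_def smult_l_minus R.l_minus intro!: bexI[of _ "\<ominus> a"])
    then show "inv\<^bsub>add_monoid R\<^esub> r \<in> multiples_on f" by (simp add: a_inv_def)
    fix s assume "s \<in> multiples_on f"
    then obtain b where s: "s \<in> carrier R" "b \<in> carrier R"
        "\<And>x. x \<in> carrier M \<Longrightarrow> s \<odot>\<^bsub>M\<^esub> x = (b \<otimes> f) \<odot>\<^bsub>M\<^esub> x" by (auto simp: multiples_on_def)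
    show "r \<otimes>\<^bsub>add_monoid R\<^esub> s \<in> multiples_on f"
      using f r s by (auto simp: multiples_on_def smult_l_distr R.l_distr intro!: bexI[of _ "a \<oplus> b"])
  qed
  fix r x assume "r \<in> multiples_on f" and x: "x \<in> carrier R"
  then obtain a where r: "r \<in> carrier R" "a \<in> carrier R"
      "\<And>x. x \<in> carrier M \<Longrightarrow> r \<odot>\<^bsub>M\<^esub> x = (a \<otimes> f) \<odot>\<^bsub>M\<^esub> x" by (auto simp: multiples_on_def)
  then show "x \<otimes> r \<in> multiples_on f"
    using f x by (auto simp: multiples_on_def smult_assoc1 intro!: bexI[of _ "x \<otimes> a"])
  then show "r \<otimes> x \<in> multiples_on f" using r x by (simp add: R.m_comm)
qed

lemma smult_mem_ideal_smult:
  "a \<in> I \<Longrightarrow> x \<in> carrier M \<Longrightarrow> a \<odot>\<^bsub>M\<^esub> x \<in> ideal_smult R I M"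
  unfolding ideal_smult_def submodule_span_def by blast

text \<open>The P-radical hypothesis enters here. It supplies enough prime submodules for
  containment among them to detect divisibility of a power of \<open>g\<close> by \<open>f\<close>
  modulo \<open>Ann M\<close>.\<close>

lemma P_radical_pow_mem_multiples_on:
  assumes rad: "P_radical_module R M" and f: "f \<in> carrier R" and g: "g \<in> carrier R"
    and Q: "\<And>Q. prime_submodule Q R M \<Longrightarrow> elt_smult f M \<subseteq> Q \<Longrightarrow> elt_smult g M \<subseteq> Q"
  shows "\<exists>n::nat. g [^] n \<in> multiples_on f"
proof (rule ccontr)
  assume "\<not> ?thesis"
  with multiples_on_ideal[OF f] g obtain P where
    P: "primeideal P R" "multiples_on f \<subseteq> P" "g \<notin> P"
    by (metis R.exists_primeideal_avoiding)
  \<comment> \<open>The coefficient \<zero> shows this; hence \<open>P\<close> contains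
    \<open>Ann M\<close> and the P-radical property applies to it.\<close>
  have "annihilator R M \<subseteq> multiples_on f"
    using f by (auto simp: annihilator_def multiples_on_def intro!: bexI[of _ \<zero>])
  with rad P have res: "residual R M (prime_radical R M (ideal_smult R P M)) = P"
    by (auto simp: P_radical_module_def)
  have "f \<in> multiples_on f" using f by (auto simp: multiples_on_def intro!: bexI[of _ \<one>])
  then have "elt_smult f M \<subseteq> ideal_smult R P M"
    using P(2) by (auto simp: elt_smult_def intro: smult_mem_ideal_smult)
  then have "elt_smult g M \<subseteq> Q" if "prime_submodule Q R M" "ideal_smult R P M \<subseteq> Q" for Q
    using Q that by blast
  \<comment> \<open>If no prime submodule contains \<open>PM\<close>, the prime radical is all of
    \<open>M\<close> and only closure under scaling is used.\<close>
  then have "elt_smult g M \<subseteq> prime_radical R M (ideal_smult R P M)"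
    using g by (auto simp: prime_radical_def elt_smult_def)
  then have "g \<in> residual R M (prime_radical R M (ideal_smult R P M))"
    using g by (auto simp: residual_def elt_smult_def)
  with P res show False by simp
qed

lemma pow_mem_multiples_on_imp_radical:
  assumes f: "f \<in> carrier R" and g: "g \<in> carrier R" and "g [^] (n::nat) \<in> multiples_on f"
  shows "g \<in> ideal_radical R (residual R M (elt_smult f M))"
proof -
  obtain a where a: "a \<in> carrier R" "\<And>x. x \<in> carrier M \<Longrightarrow> (g [^] n) \<odot>\<^bsub>M\<^esub> x = (a \<otimes> f) \<odot>\<^bsub>M\<^esub> x"
    using assms by (auto simp: multiples_on_def)
  \<comment> \<open>The given \<open>n\<close> may be 0, while the radical requires a positive
    exponent; one more factor \<open>g\<close> is harmless.\<close>
  have "(g [^] Suc n) \<odot>\<^bsub>M\<^esub> x \<in> elt_smult f M" if x: "x \<in> carrier M" for x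
  proof -
    have "(g [^] Suc n) \<odot>\<^bsub>M\<^esub> x = (g [^] n) \<odot>\<^bsub>M\<^esub> (g \<odot>\<^bsub>M\<^esub> x)"
      using g x by (simp add: smult_assoc1)
    also have "\<dots> = f \<odot>\<^bsub>M\<^esub> (a \<odot>\<^bsub>M\<^esub> (g \<odot>\<^bsub>M\<^esub> x))"
      using a f g x by (simp add: R.m_comm[of a f] smult_assoc1)
    finally show ?thesis using a g x by (auto simp: elt_smult_def)
  qed
  then show ?thesis using g unfolding ideal_radical_def residual_def by blast
qed

text \<open>Some \<open>g [^] n\<close> maps \<open>M\<close> into \<open>fM\<close>, hence into
  \<open>Q\<close>. If \<open>gM\<close> were not inside \<open>Q\<close>, stripping the powers
  would give \<open>Q = M\<close>.\<close>

lemma radical_imp_prime_submodule: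
  assumes f: "f \<in> carrier R" and g: "g \<in> ideal_radical R (residual R M (elt_smult f M))"
    and Q: "prime_submodule Q R M" "elt_smult f M \<subseteq> Q"
  shows "elt_smult g M \<subseteq> Q"
proof (rule ccontr)
  assume no: "\<not> ?thesis"
  obtain n :: nat where n: "g \<in> carrier R" "\<And>x. x \<in> carrier M \<Longrightarrow> (g [^] n) \<odot>\<^bsub>M\<^esub> x \<in> elt_smult f M"
    using g by (auto simp: ideal_radical_def residual_def)
  then have "x \<in> Q" if "x \<in> carrier M" for x
    using smult_pow_in_prime_submodule[OF Q(1), of g x n] Q(2) no that by blast
  then show False using no n by (auto simp: elt_smult_def)
qed

text \<open>Membership of a power of \<open>g\<close> in \<open>multiples_on f\<close> is the
  intermediate condition that closes a cycle of three implications.\<close>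

lemma P_radical_radical_iff:
  assumes "P_radical_module R M" "f \<in> carrier R"
  shows "g \<in> ideal_radical R (residual R M (elt_smult f M)) \<longleftrightarrow> g \<in> carrier R \<and>
    (\<forall>Q. prime_submodule Q R M \<longrightarrow> elt_smult f M \<subseteq> Q \<longrightarrow> elt_smult g M \<subseteq> Q)"
proof -
  have "g \<in> carrier R" if "g \<in> ideal_radical R (residual R M (elt_smult f M))"
    using that by (simp add: ideal_radical_def)
  then show ?thesis
    using P_radical_pow_mem_multiples_on[OF assms] pow_mem_multiples_on_imp_radical[OF assms(2)]
      radical_imp_prime_submodule[OF assms(2)] by metis
qed

section \<open>Saturation of a multiplicative set and its effect on localization\<close>

text \<open>The elements of \<open>R\<close> that become units of \<open>S\<inverse>(R/Ann M)\<close>.\<close>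

definition saturation_on :: "'a set \<Rightarrow> 'a set" where
  "saturation_on S = {t \<in> carrier R. \<exists>r\<in>carrier R. \<exists>s\<in>S. \<forall>x\<in>carrier M. (r \<otimes> t) \<odot>\<^bsub>M\<^esub> x = s \<odot>\<^bsub>M\<^esub> x}"

context
  fixes S
  assumes S: "submonoid S R"
begin

lemma saturation_on_submonoid: "submonoid (saturation_on S) R"
proof
  show "saturation_on S \<subseteq> carrier R" by (auto simp: saturation_on_def)
  show "\<one> \<in> saturation_on S"
    using den_one[OF S] by (auto simp: saturation_on_def intro!: bexI[of _ \<one>])
  fix t t' assume "t \<in> saturation_on S" "t' \<in> saturation_on S"
  then obtain r s r' s' where 1: "t \<in> carrier R" "r \<in> carrier R" "s \<in> S"
      "\<And>x. x \<in> carrier M \<Longrightarrow> (r \<otimes> t) \<odot>\<^bsub>M\<^esub> x = s \<odot>\<^bsub>M\<^esub> x"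
      "t' \<in> carrier R" "r' \<in> carrier R" "s' \<in> S"
      "\<And>x. x \<in> carrier M \<Longrightarrow> (r' \<otimes> t') \<odot>\<^bsub>M\<^esub> x = s' \<odot>\<^bsub>M\<^esub> x"
    by (auto simp: saturation_on_def)
  have "((r \<otimes> r') \<otimes> (t \<otimes> t')) \<odot>\<^bsub>M\<^esub> x = (s \<otimes> s') \<odot>\<^bsub>M\<^esub> x" if x: "x \<in> carrier M" for x
  proof -
    have "(r \<otimes> r') \<otimes> (t \<otimes> t') = (r \<otimes> t) \<otimes> (r' \<otimes> t')" using 1 by (simp add: R.m_ac)
    then show ?thesis using 1 x den_closed[OF S]
      by (simp add: smult_assoc1[of "r \<otimes> t"] smult_assoc1[of s])
  qed
  then show "t \<otimes> t' \<in> saturation_on S"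
    using 1 den_mult[OF S]
    by (auto simp: saturation_on_def intro!: bexI[of _ "r \<otimes> r'"] bexI[of _ "s \<otimes> s'" S])
qed

lemma subset_saturation_on: "S \<subseteq> saturation_on S"
proof
  fix s assume "s \<in> S"
  then show "s \<in> saturation_on S"
    using den_closed[OF S] by (auto simp: saturation_on_def intro!: bexI[of _ \<one>] bexI[of _ s S])
qed

text \<open>Divisibility modulo \<open>Ann M\<close> is transitive. Thus two submonoids, each inside
  the saturation of the other, have the same saturation.\<close>

lemma saturation_on_subset:
  assumes S': "submonoid S' R" and sub: "S' \<subseteq> saturation_on S"
  shows "saturation_on S' \<subseteq> saturation_on S"
proof
  fix t assume "t \<in> saturation_on S'"
  then obtain r s where 1: "t \<in> carrier R" "r \<in> carrier R" "s \<in> S'"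
      "\<And>x. x \<in> carrier M \<Longrightarrow> (r \<otimes> t) \<odot>\<^bsub>M\<^esub> x = s \<odot>\<^bsub>M\<^esub> x"
    by (auto simp: saturation_on_def)
  then obtain r' s' where 2: "s \<in> carrier R" "r' \<in> carrier R" "s' \<in> S"
      "\<And>x. x \<in> carrier M \<Longrightarrow> (r' \<otimes> s) \<odot>\<^bsub>M\<^esub> x = s' \<odot>\<^bsub>M\<^esub> x"
    using sub by (auto simp: saturation_on_def)
  have "((r' \<otimes> r) \<otimes> t) \<odot>\<^bsub>M\<^esub> x = s' \<odot>\<^bsub>M\<^esub> x" if x: "x \<in> carrier M" for x
  proof -
    have "((r' \<otimes> r) \<otimes> t) \<odot>\<^bsub>M\<^esub> x = r' \<odot>\<^bsub>M\<^esub> ((r \<otimes> t) \<odot>\<^bsub>M\<^esub> x)"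
      using 1(1,2) 2(2) x by (simp add: R.m_assoc smult_assoc1)
    also have "\<dots> = s' \<odot>\<^bsub>M\<^esub> x" using 1(4) 2 x by (simp add: smult_assoc1)
    finally show ?thesis .
  qed
  then show "t \<in> saturation_on S" using 1 2 by (auto simp: saturation_on_def)
qed

text \<open>If \<open>r \<otimes> t\<close> acts as an element of \<open>S\<close>, then
  \<open>t\<close> already acts invertibly on the localization at \<open>S\<close>, so admitting
  \<open>t\<close> as a denominator changes nothing.\<close>

lemma localization_saturation_on_isomorphic:
  "module_isomorphic R (localization R S M) (localization R (saturation_on S) M)"
proof -
  let ?T = "saturation_on S"
  note T = saturation_on_submonoid
  note ST = subset_saturation_on
  \<comment> \<open>This is the map \<open>m/s\<close> to \<open>m/s\<close>. Enlarging the
    denominators coarsens the fraction relation, so all the classes united here coincide.\<close>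
  define h where "h X = (\<Union>(m, s) \<in> X. fraction R ?T M m s)" for X
  have h: "h (fraction R S M m s) = fraction R ?T M m s" if ms: "m \<in> carrier M" "s \<in> S" for m s
    unfolding h_def
  proof (rule UN_pair_const)
    show "(m, s) \<in> fraction R S M m s" using ms by (simp add: mem_fraction_iff[OF S])
    fix n t assume "(n, t) \<in> fraction R S M m s"
    then obtain u where "n \<in> carrier M" "t \<in> S" "u \<in> S"
        "u \<odot>\<^bsub>M\<^esub> (s \<odot>\<^bsub>M\<^esub> n) = u \<odot>\<^bsub>M\<^esub> (t \<odot>\<^bsub>M\<^esub> m)"
      using ms by (auto simp: mem_fraction_iff[OF S] fraction_eq_iff[OF S])
    then show "fraction R ?T M n t = fraction R ?T M m s"
      using ms ST by (subst fraction_eq_iff[OF T]) auto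
  qed
  have "inj_on h (carrier (localization R S M))"
  proof (rule inj_onI)
    fix X Y assume "X \<in> carrier (localization R S M)" "Y \<in> carrier (localization R S M)" "h X = h Y"
    then obtain m s n t where 1: "m \<in> carrier M" "s \<in> S" "n \<in> carrier M" "t \<in> S"
        "X = fraction R S M m s" "Y = fraction R S M n t"
        "fraction R ?T M m s = fraction R ?T M n t"
      by (auto simp: localization_carrier[OF S] h)
    then obtain u where u: "u \<in> ?T" "u \<odot>\<^bsub>M\<^esub> (t \<odot>\<^bsub>M\<^esub> m) = u \<odot>\<^bsub>M\<^esub> (s \<odot>\<^bsub>M\<^esub> n)"
      using fraction_eq_iff[OF T 1(1) subsetD[OF ST 1(2)] 1(3) subsetD[OF ST 1(4)]] by blast
    then obtain r v where r: "u \<in> carrier R" "r \<in> carrier R" "v \<in> S"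
      "\<And>x. x \<in> carrier M \<Longrightarrow> (r \<otimes> u) \<odot>\<^bsub>M\<^esub> x = v \<odot>\<^bsub>M\<^esub> x"
      by (auto simp: saturation_on_def)
    \<comment> \<open>Multiplying the equation witnessed by \<open>u\<close> with \<open>r\<close>
      gives one witnessed by \<open>v\<close>, which lies in \<open>S\<close>.\<close>
    have "v \<odot>\<^bsub>M\<^esub> (t \<odot>\<^bsub>M\<^esub> m) = v \<odot>\<^bsub>M\<^esub> (s \<odot>\<^bsub>M\<^esub> n)"
      using 1 u(2) r den_closed[OF S] by (simp add: r(4)[symmetric] smult_assoc1)
    then show "X = Y" using 1 r by (auto simp: fraction_eq_iff[OF S])
  qed
  moreover have "h ` carrier (localization R S M) = carrier (localization R ?T M)"
  proof (intro equalityI subsetI)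
    fix Y assume "Y \<in> h ` carrier (localization R S M)"
    then show "Y \<in> carrier (localization R ?T M)"
      using ST unfolding localization_carrier[OF S] localization_carrier[OF T]
      by (clarsimp simp: h) blast
  next
    fix Y assume "Y \<in> carrier (localization R ?T M)"
    then obtain m t where Y: "m \<in> carrier M" "t \<in> ?T" "Y = fraction R ?T M m t"
      by (auto simp: localization_carrier[OF T])
    then obtain r s where r: "t \<in> carrier R" "r \<in> carrier R" "s \<in> S"
      "\<And>x. x \<in> carrier M \<Longrightarrow> (r \<otimes> t) \<odot>\<^bsub>M\<^esub> x = s \<odot>\<^bsub>M\<^esub> x"
      by (auto simp: saturation_on_def)
    \<comment> \<open>This says \<open>m/t = rm/s\<close>, which supplies a preimage with
      denominator in \<open>S\<close>.\<close>
    have "t \<odot>\<^bsub>M\<^esub> (r \<odot>\<^bsub>M\<^esub> m) = s \<odot>\<^bsub>M\<^esub> m"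
      using r Y(1) by (simp add: r(4)[symmetric] smult_assoc1[symmetric] R.m_comm)
    then have "fraction R ?T M (r \<odot>\<^bsub>M\<^esub> m) s = Y"
      unfolding Y(3) using Y(1,2) r(2,3) ST den_one[OF T] by (subst fraction_eq_iff[OF T]) auto
    then have "Y = h (fraction R S M (r \<odot>\<^bsub>M\<^esub> m) s)" using r Y(1) by (simp add: h)
    moreover have "fraction R S M (r \<odot>\<^bsub>M\<^esub> m) s \<in> carrier (localization R S M)"
      using r Y(1) by (auto simp: localization_carrier[OF S])
    ultimately show "Y \<in> h ` carrier (localization R S M)" by (rule image_eqI)
  qed
  moreover have "h (X \<oplus>\<^bsub>localization R S M\<^esub> Y) = h X \<oplus>\<^bsub>localization R ?T M\<^esub> h Y"
    if XY: "X \<in> carrier (localization R S M)" "Y \<in> carrier (localization R S M)" for X Y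
  proof -
    obtain m s n t where 1: "m \<in> carrier M" "s \<in> S" "n \<in> carrier M" "t \<in> S"
        "X = fraction R S M m s" "Y = fraction R S M n t"
      using XY by (auto simp: localization_carrier[OF S])
    with ST show ?thesis
      by (auto simp: h localization_add_fraction[OF S] localization_add_fraction[OF T]
          den_closed[OF S] den_mult[OF S] subset_iff)
  qed
  moreover have "h (r \<odot>\<^bsub>localization R S M\<^esub> X) = r \<odot>\<^bsub>localization R ?T M\<^esub> h X"
    if rX: "r \<in> carrier R" "X \<in> carrier (localization R S M)" for r X
  proof -
    obtain m s where 1: "m \<in> carrier M" "s \<in> S" "X = fraction R S M m s"
      using rX by (auto simp: localization_carrier[OF S])
    with ST rX show ?thesis
      by (auto simp: h localization_smult_fraction[OF S] localization_smult_fraction[OF T] subset_iff)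
  qed
  ultimately have "h \<in> module_iso R (localization R S M) (localization R ?T M)"
    by (simp add: module_iso_def bij_betw_def)
  then show ?thesis by (auto simp: module_isomorphic_def)
qed

end

text \<open>The equation \<open>g^n = af\<close> on \<open>M\<close> also says that \<open>f\<close>
  divides a power of \<open>g\<close> there, so \<open>f\<close> and hence all its powers lie in the
  saturation.\<close>

lemma powers_of_subset_saturation_on:
  assumes f: "f \<in> carrier R" and g: "g \<in> carrier R" and "g [^] (n::nat) \<in> multiples_on f"
  shows "powers_of R f \<subseteq> saturation_on (powers_of R g)"
proof -
  note sub = saturation_on_submonoid[OF R.powers_of_submonoid[OF g]]
  obtain a where "a \<in> carrier R" "\<And>x. x \<in> carrier M \<Longrightarrow> (g [^] n) \<odot>\<^bsub>M\<^esub> x = (a \<otimes> f) \<odot>\<^bsub>M\<^esub> x"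
    using assms(3) by (auto simp: multiples_on_def)
  then have "f \<in> saturation_on (powers_of R g)"
    using f unfolding saturation_on_def powers_of_def by simp metis
  then have "f [^] (k::nat) \<in> saturation_on (powers_of R g)" for k
    by (induction k) (auto simp: submonoid.one_closed[OF sub] submonoid.m_closed[OF sub])
  then show ?thesis by (auto simp: powers_of_def)
qed

section \<open>Surjective multiplication on a localization\<close>

text \<open>The preimage of \<open>m/s\<close> is \<open>m/(fs)\<close>.\<close>

lemma smult_surj_localization_at:
  assumes f: "f \<in> carrier R" and x: "x \<in> carrier (localization_at R M f)"
  shows "\<exists>y \<in> carrier (localization_at R M f). x = f \<odot>\<^bsub>localization_at R M f\<^esub> y"
proof -
  let ?S = "powers_of R f"
  note S = R.powers_of_submonoid[OF f]
  have fS: "f \<in> ?S" using f by (auto simp: powers_of_def intro!: exI[of _ 1])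
  obtain m s where ms: "m \<in> carrier M" "s \<in> ?S" "x = fraction R ?S M m s"
    using x by (auto simp: localization_at_def localization_carrier[OF S])
  have sc: "s \<in> carrier R" using ms den_closed[OF S] by blast
  have fs: "f \<otimes> s \<in> ?S" using den_mult[OF S fS] ms by blast
  have "x = fraction R ?S M (f \<odot>\<^bsub>M\<^esub> m) (f \<otimes> s)"
    unfolding ms(3) using ms f fs sc den_one[OF S]
    by (subst fraction_eq_iff[OF S]) (auto simp: R.m_comm[of f s] smult_assoc1)
  also have "\<dots> = f \<odot>\<^bsub>localization_at R M f\<^esub> fraction R ?S M m (f \<otimes> s)"
    using ms f fs by (simp add: localization_at_def localization_smult_fraction[OF S])
  finally show ?thesis using ms fs
    by (auto simp: localization_at_def localization_carrier[OF S])
qed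

text \<open>Writing \<open>m/1\<close> as \<open>f\<close> times a fraction and clearing
  denominators puts some \<open>g^k m\<close> in \<open>fM\<close>, hence in \<open>Q\<close>. If
  \<open>gM\<close> were not inside \<open>Q\<close>, this would force every \<open>m\<close> into
  \<open>Q\<close>.\<close>

lemma prime_submodule_of_smult_surj:
  assumes f: "f \<in> carrier R" and g: "g \<in> carrier R"
    and surj: "\<And>x. x \<in> carrier (localization_at R M g) \<Longrightarrow>
      \<exists>y \<in> carrier (localization_at R M g). x = f \<odot>\<^bsub>localization_at R M g\<^esub> y"
    and Q: "prime_submodule Q R M" "elt_smult f M \<subseteq> Q"
  shows "elt_smult g M \<subseteq> Q"
proof (rule ccontr)
  assume no: "\<not> ?thesis"
  let ?S = "powers_of R g"
  note S = R.powers_of_submonoid[OF g]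
  have "m \<in> Q" if m: "m \<in> carrier M" for m
  proof -
    have "fraction R ?S M m \<one> \<in> carrier (localization_at R M g)"
      using m den_one[OF S] by (auto simp: localization_at_def localization_carrier[OF S])
    from surj[OF this] obtain n s where n: "n \<in> carrier M" "s \<in> ?S"
      "fraction R ?S M m \<one> = fraction R ?S M (f \<odot>\<^bsub>M\<^esub> n) s"
      using f by (auto simp: localization_at_def localization_carrier[OF S] localization_smult_fraction[OF S])
    then obtain u where u: "u \<in> ?S" "u \<odot>\<^bsub>M\<^esub> (s \<odot>\<^bsub>M\<^esub> m) = u \<odot>\<^bsub>M\<^esub> (f \<odot>\<^bsub>M\<^esub> n)"
      using m f den_one[OF S] by (auto simp: fraction_eq_iff[OF S])
    have c: "u \<in> carrier R" "s \<in> carrier R" using u n den_closed[OF S] by auto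
    have "u \<otimes> s \<in> ?S" using u n den_mult[OF S] by blast
    then obtain k :: nat where k: "u \<otimes> s = g [^] k" by (auto simp: powers_of_def)
    have "(g [^] k) \<odot>\<^bsub>M\<^esub> m = f \<odot>\<^bsub>M\<^esub> (u \<odot>\<^bsub>M\<^esub> n)"
      using u c m n f by (simp add: k[symmetric] smult_assoc1 smult_left_commute[OF S])
    also have "\<dots> \<in> Q" using Q(2) c n by (auto simp: elt_smult_def)
    finally show ?thesis using smult_pow_in_prime_submodule[OF Q(1) g m] no by blast
  qed
  then show False using no g by (auto simp: elt_smult_def)
qed

end

section \<open>Isomorphisms of modules\<close>

text \<open>The module structure of \<open>M\<close> makes sums and multiples stay in
  \<open>carrier M\<close>, where the inverse map undoes \<open>h\<close>.\<close>

lemma module_isomorphic_sym: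
  assumes "module R M" and "module_isomorphic R M N"
  shows "module_isomorphic R N M"
proof -
  interpret module R M by fact
  obtain h where h: "bij_betw h (carrier M) (carrier N)"
    "\<And>x y. x \<in> carrier M \<Longrightarrow> y \<in> carrier M \<Longrightarrow> h (x \<oplus>\<^bsub>M\<^esub> y) = h x \<oplus>\<^bsub>N\<^esub> h y"
    "\<And>r x. r \<in> carrier R \<Longrightarrow> x \<in> carrier M \<Longrightarrow> h (r \<odot>\<^bsub>M\<^esub> x) = r \<odot>\<^bsub>N\<^esub> h x"
    using assms(2) by (auto simp: module_isomorphic_def module_iso_def)
  let ?k = "the_inv_into (carrier M) h"
  have inj: "inj_on h (carrier M)" using h(1) by (rule bij_betw_imp_inj_on)
  have kh: "?k (h x) = x" if "x \<in> carrier M" for x using that inj by (rule the_inv_into_f_f[rotated])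
  have N: "carrier N = h ` carrier M" using h(1) by (simp add: bij_betw_def)
  have "?k \<in> module_iso R N M"
    using bij_betw_the_inv_into[OF h(1)]
    by (auto simp: module_iso_def N kh h(2,3)[symmetric])
  then show ?thesis by (auto simp: module_isomorphic_def)
qed

lemma module_isomorphic_trans:
  assumes "module_isomorphic R M N" and "module_isomorphic R N K"
  shows "module_isomorphic R M K"
proof -
  obtain h k where hk: "h \<in> module_iso R M N" "k \<in> module_iso R N K"
    using assms by (auto simp: module_isomorphic_def)
  then have "h x \<in> carrier N" if "x \<in> carrier M" for x
    using that by (auto simp: module_iso_def bij_betw_def)
  with hk have "k \<circ> h \<in> module_iso R M K"
    by (auto simp: module_iso_def intro: bij_betw_trans)
  then show ?thesis by (auto simp: module_isomorphic_def)
qed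

lemma module_isomorphic_smult_surj:
  assumes "module_isomorphic R M N" and r: "r \<in> carrier R"
    and surj: "\<And>x. x \<in> carrier M \<Longrightarrow> \<exists>y\<in>carrier M. x = r \<odot>\<^bsub>M\<^esub> y"
    and x: "x \<in> carrier N"
  shows "\<exists>y\<in>carrier N. x = r \<odot>\<^bsub>N\<^esub> y"
proof -
  obtain h where h: "h ` carrier M = carrier N"
    "\<And>y. y \<in> carrier M \<Longrightarrow> h (r \<odot>\<^bsub>M\<^esub> y) = r \<odot>\<^bsub>N\<^esub> h y"
    using assms(1) r by (auto simp: module_isomorphic_def module_iso_def bij_betw_def)
  obtain z where z: "z \<in> carrier M" "x = h z" using h(1) x by blast
  then obtain y where "y \<in> carrier M" "z = r \<odot>\<^bsub>M\<^esub> y" using surj by blast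
  then show ?thesis using h z by blast
qed

theorem theorem4p1:
  fixes R :: "('a, 'r) ring_scheme" and M :: "('a, 'b, 'm) module_scheme" and f g :: 'a
  assumes "cring R" and "\<one>\<^bsub>R\<^esub> \<noteq> \<zero>\<^bsub>R\<^esub>"
    and "module R M" and "P_radical_module R M"
    and "f \<in> carrier R" and "g \<in> carrier R"
  shows "module_isomorphic R (localization_at R M f) (localization_at R M g) \<longleftrightarrow>
         ideal_radical R (residual R M (elt_smult f M)) =
         ideal_radical R (residual R M (elt_smult g M))"
proof -
  interpret module R M by fact
  note rad = \<open>P_radical_module R M\<close> and f = \<open>f \<in> carrier R\<close> and g = \<open>g \<in> carrier R\<close>
  note Sf = R.powers_of_submonoid[OF f] and Sg = R.powers_of_submonoid[OF g]
  have modf: "module R (localization_at R M f)"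
    unfolding localization_at_def by (rule localization_module[OF Sf])
  show ?thesis
  proof
    assume iso: "module_isomorphic R (localization_at R M f) (localization_at R M g)"
    \<comment> \<open>Multiplication by \<open>f\<close> is surjective on \<open>M_f\<close>, hence
      through the isomorphism on \<open>M_g\<close>.\<close>
    have "elt_smult g M \<subseteq> Q" if "prime_submodule Q R M" "elt_smult f M \<subseteq> Q" for Q
      using prime_submodule_of_smult_surj[OF f g _ that]
        module_isomorphic_smult_surj[OF iso f smult_surj_localization_at[OF f]] by blast
    moreover have "elt_smult f M \<subseteq> Q" if "prime_submodule Q R M" "elt_smult g M \<subseteq> Q" for Q
      using prime_submodule_of_smult_surj[OF g f _ that]
        module_isomorphic_smult_surj[OF module_isomorphic_sym[OF modf iso] g
          smult_surj_localization_at[OF g]] by blast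
    ultimately show "ideal_radical R (residual R M (elt_smult f M)) =
        ideal_radical R (residual R M (elt_smult g M))"
      by (auto simp: P_radical_radical_iff[OF rad f] P_radical_radical_iff[OF rad g])
  next
    assume eq: "ideal_radical R (residual R M (elt_smult f M)) =
        ideal_radical R (residual R M (elt_smult g M))"
    \<comment> \<open>In the prime submodule criterion both containments are the same, so each
      element lies in its own radical.\<close>
    have "f \<in> ideal_radical R (residual R M (elt_smult f M))"
      "g \<in> ideal_radical R (residual R M (elt_smult g M))"
      using f g by (simp_all add: P_radical_radical_iff[OF rad])
    \<comment> \<open>By \<open>eq\<close> each element also lies in the radical of the other, so
      the criterion yields divisibility of powers both ways.\<close>
    then obtain i j :: nat where "f [^]\<^bsub>R\<^esub> i \<in> multiples_on g" "g [^]\<^bsub>R\<^esub> j \<in> multiples_on f"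
      using P_radical_pow_mem_multiples_on[OF rad] P_radical_radical_iff[OF rad] f g eq by metis
    then have "saturation_on (powers_of R f) = saturation_on (powers_of R g)"
      using f g Sf Sg saturation_on_subset powers_of_subset_saturation_on by (intro equalityI) metis+
    \<comment> \<open>Both localizations are isomorphic to the localization at the common
      saturation.\<close>
    then show "module_isomorphic R (localization_at R M f) (localization_at R M g)"
      unfolding localization_at_def
      using localization_saturation_on_isomorphic[OF Sf] localization_saturation_on_isomorphic[OF Sg]
        module_isomorphic_sym[OF localization_module[OF Sg]] module_isomorphic_trans by metis
  qed
qed

end
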